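(* For every BPPS instance (with $k$ a valid upper bound on the number of bins and $\mathcal B=\{1,\dots,k\}$), an optimal solution to the linear program $\mathrm{LP}^{\dagger}_{\mathrm N}$ is $$x_{ib}=\frac1k\ \ (i\in\mathcal I,\ b\in\mathcal B),\qquad y_{cb}=\frac{\gamma_c}{k}\ \ (c\in\mathcal C,\ b\in\mathcal B),\qquad z_b=\frac{\sum_{i\in\mathcal I}w_i+\sum_{c\in\mathcal C}\gamma_c\,s_c}{k\,d}\ \ (b\in\mathcal B),$$ and its optimal objective function value is $$\zeta(\mathrm{LP}^{\dagger}_{\mathrm N})=\frac{r}{d}\Big(\sum_{i\in\mathcal I}w_i+\sum_{c\in\mathcal C}\gamma_c\,s_c\Big)+\sum_{c\in\mathcal C}\gamma_c\,f_c.$$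
   Context: Bin Packing Problem with Setups (BPPS). An instance consists of: a bin capacity $d\in\mathbb Z_{\ge1}$; items $\mathcal I=\{1,\dots,n\}$ with weights $w_i\in\mathbb Z_{\ge1}$; classes $\mathcal C=\{1,\dots,m\}$ and a partition $\{\mathcal I_1,\dots,\mathcal I_m\}$ of $\mathcal I$ into (nonempty) classes; for each class $c$ a setup weight $s_c\in\mathbb Z_{\ge0}$ and a setup cost $f_c\in\mathbb Z_{\ge0}$; a bin cost $r\in\mathbb Z_{\ge1}$. It is assumed that $w_i+s_c\le d$ for all $c\in\mathcal C$, $i\in\mathcal I_c$, and that the items cannot all be packed in a single bin, i.e. $\sum_{i\in\mathcal I}w_i+\sum_{c\in\mathcal C}s_c>d$. For $S\subseteq\mathcal I$ let $\mathcal C(S)=\{c\in\mathcal C: S\cap\mathcal I_c\neq\emptyset\}$. A packing pattern is a subset $S\subseteq\mathcal I$ with $\sum_{i\in S}w_i+\sum_{c\in\mathcal C(S)}s_c\le d$. A feasible solution is a partition $\mathcal S$ of $\mathcal I$ into (nonempty) packing patterns (used bins); its cost is $r|\mathcal S|+\sum_{S\in\mathcal S}\sum_{c\in\mathcal C(S)}f_c$. The problem is to find a feasible solution of minimum cost. For $c\in\mathcal C$ let $\gamma_c=\left\lceil\frac{\sum_{i\in\mathcal I_c}w_i}{d-s_c}\right\rceil$. Let $k\in\mathbb Z_{\ge1}$ be an upper bound on the number of bins used in any optimal BPPS solution and $\mathcal B=\{1,\dots,k\}$. The linear program $\mathrm{LP}^{\dagger}_{\mathrm N}$ is: minimize $\sum_{b\in\mathcal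 B}\big(r z_b+\sum_{c\in\mathcal C}f_c y_{cb}\big)$ subject to - $\sum_{b\in\mathcal B}x_{ib}=1$ for all $i\in\mathcal I$; - $\sum_{i\in\mathcal I}w_ix_{ib}+\sum_{c\in\mathcal C}s_cy_{cb}\le d\,z_b$ for all $b\in\mathcal B$; - $x_{ib}\le y_{cb}$ for all $c\in\mathcal C$, $i\in\mathcal I_c$, $b\in\mathcal B$; - $\sum_{b\in\mathcal B}y_{cb}\ge\gamma_c$ for all $c\in\mathcal C$ (Minimum Classes Inequalities); - $0\le x_{ib}\le1$, $0\le y_{cb}\le1$, $0\le z_b\le1$ for all $i\in\mathcal I,c\in\mathcal C,b\in\mathcal B$. $\zeta(\mathrm{LP}^{\dagger}_{\mathrm N})$ denotes its optimal objective function value. *)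

theory Defs
  imports Complex_Main "HOL-Library.Disjoint_Sets"
begin

text \<open>
  Items are \<open>{1..num_items P}\<close>, classes are \<open>{1..num_classes P}\<close>, and
  \<open>class_items P c\<close> is the set of items of class \<open>c\<close>.  The integer data are natural
  numbers; only their values at actual items and classes matter.
\<close>

record bpps =
  capacity :: nat
  num_items :: nat
  weight :: "nat \<Rightarrow> nat"
  num_classes :: nat
  class_items :: "nat \<Rightarrow> nat set"
  setup_weight :: "nat \<Rightarrow> nat"
  setup_cost :: "nat \<Rightarrow> nat"
  bin_cost :: nat

definition items :: "bpps \<Rightarrow> nat set" where
  "items P = {1..num_items P}"

definition classes :: "bpps \<Rightarrow> nat set" where
  "classes P = {1..num_classes P}"

definition bpps_instance :: "bpps \<Rightarrow> bool" where
  "bpps_instance P \<longleftrightarrow>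
     capacity P \<ge> 1 \<and>
     bin_cost P \<ge> 1 \<and>
     (\<forall>i\<in>items P. weight P i \<ge> 1) \<and>
     (\<forall>c\<in>classes P. class_items P c \<noteq> {}) \<and>
     disjoint_family_on (class_items P) (classes P) \<and>
     (\<Union>c\<in>classes P. class_items P c) = items P \<and>
     (\<forall>c\<in>classes P. \<forall>i\<in>class_items P c. weight P i + setup_weight P c \<le> capacity P) \<and>
     (\<Sum>i\<in>items P. weight P i) + (\<Sum>c\<in>classes P. setup_weight P c) > capacity P"

definition classes_of :: "bpps \<Rightarrow> nat set \<Rightarrow> nat set" where
  "classes_of P S = {c \<in> classes P. S \<inter> class_items P c \<noteq> {}}"

definition packing_pattern :: "bpps \<Rightarrow> nat set \<Rightarrow> bool" where
  "packing_pattern P S \<longleftrightarrow>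
     S \<subseteq> items P \<and>
     (\<Sum>i\<in>S. weight P i) + (\<Sum>c\<in>classes_of P S. setup_weight P c) \<le> capacity P"

definition bpps_feasible :: "bpps \<Rightarrow> nat set set \<Rightarrow> bool" where
  "bpps_feasible P \<S> \<longleftrightarrow> partition_on (items P) \<S> \<and> (\<forall>S\<in>\<S>. packing_pattern P S)"

definition bpps_cost :: "bpps \<Rightarrow> nat set set \<Rightarrow> nat" where
  "bpps_cost P \<S> = bin_cost P * card \<S> + (\<Sum>S\<in>\<S>. \<Sum>c\<in>classes_of P S. setup_cost P c)"

definition bpps_optimal :: "bpps \<Rightarrow> nat set set \<Rightarrow> bool" where
  "bpps_optimal P \<S> \<longleftrightarrow>
     bpps_feasible P \<S> \<and> (\<forall>\<T>. bpps_feasible P \<T> \<longrightarrow> bpps_cost P \<S> \<le> bpps_cost P \<T>)"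

definition bins_upper_bound :: "bpps \<Rightarrow> nat \<Rightarrow> bool" where
  "bins_upper_bound P k \<longleftrightarrow> k \<ge> 1 \<and> (\<forall>\<S>. bpps_optimal P \<S> \<longrightarrow> card \<S> \<le> k)"

definition gamma :: "bpps \<Rightarrow> nat \<Rightarrow> int" where
  "gamma P c =
     \<lceil>real (\<Sum>i\<in>class_items P c. weight P i) / (real (capacity P) - real (setup_weight P c))\<rceil>"

definition lp_feasible ::
  "bpps \<Rightarrow> nat \<Rightarrow> (nat \<Rightarrow> nat \<Rightarrow> real) \<Rightarrow> (nat \<Rightarrow> nat \<Rightarrow> real) \<Rightarrow> (nat \<Rightarrow> real) \<Rightarrow> bool" where
  "lp_feasible P k x y z \<longleftrightarrow>
     (\<forall>i\<in>items P. (\<Sum>b\<in>{1..k}. x i b) = 1) \<and>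
     (\<forall>b\<in>{1..k}.
        (\<Sum>i\<in>items P. real (weight P i) * x i b)
          + (\<Sum>c\<in>classes P. real (setup_weight P c) * y c b) \<le> real (capacity P) * z b) \<and>
     (\<forall>c\<in>classes P. \<forall>i\<in>class_items P c. \<forall>b\<in>{1..k}. x i b \<le> y c b) \<and>
     (\<forall>c\<in>classes P. (\<Sum>b\<in>{1..k}. y c b) \<ge> real_of_int (gamma P c)) \<and>
     (\<forall>i\<in>items P. \<forall>b\<in>{1..k}. 0 \<le> x i b \<and> x i b \<le> 1) \<and>
     (\<forall>c\<in>classes P. \<forall>b\<in>{1..k}. 0 \<le> y c b \<and> y c b \<le> 1) \<and>
     (\<forall>b\<in>{1..k}. 0 \<le> z b \<and> z b \<le> 1)"

definition lp_objective ::
  "bpps \<Rightarrow> nat \<Rightarrow> (nat \<Rightarrow> nat \<Rightarrow> real) \<Rightarrow> (nat \<Rightarrow> real) \<Rightarrow> real" where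
  "lp_objective P k y z =
     (\<Sum>b\<in>{1..k}. real (bin_cost P) * z b + (\<Sum>c\<in>classes P. real (setup_cost P c) * y c b))"

definition lp_optimal ::
  "bpps \<Rightarrow> nat \<Rightarrow> (nat \<Rightarrow> nat \<Rightarrow> real) \<Rightarrow> (nat \<Rightarrow> nat \<Rightarrow> real) \<Rightarrow> (nat \<Rightarrow> real) \<Rightarrow> bool" where
  "lp_optimal P k x y z \<longleftrightarrow>
     lp_feasible P k x y z \<and>
     (\<forall>x' y' z'. lp_feasible P k x' y' z' \<longrightarrow> lp_objective P k y z \<le> lp_objective P k y' z')"

text \<open>
  The infimum is the optimal value only when the feasible set is nonempty and the objective is
  bounded below on it; both hold whenever some triple satisfies \<open>lp_optimal\<close>.
\<close>

definition lp_value :: "bpps \<Rightarrow> nat \<Rightarrow> real" where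
  "lp_value P k = Inf {lp_objective P k y z |x y z. lp_feasible P k x y z}"

end

theory Submission
  imports Defs
begin

text \<open>
  Summing the capacity constraints over the bins and inserting the assignment constraints and the
  minimum classes inequalities bounds the objective from below by the claimed value, which the
  uniform solution attains.  The only delicate point is that the uniform solution respects the upper
  bounds \<open>1\<close>: in an optimal packing, class \<open>c\<close> occurs in at least \<open>\<gamma>\<^sub>c\<close> of the at most \<open>k\<close> bins, so
  \<open>\<gamma>\<^sub>c \<le> k\<close>, and \<open>\<Sum>w\<^sub>i + \<Sum>\<gamma>\<^sub>cs\<^sub>c\<close> is at most the total load, hence at most \<open>k d\<close>.
\<close>

section \<open>Finiteness and elementary bounds on an instance\<close>

lemma finite_items [simp]: "finite (items P)"
  by (simp add: items_def)

lemma finite_classes [simp]: "finite (classes P)"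
  by (simp add: classes_def)

lemma finite_classes_of [simp]: "finite (classes_of P S)"
  by (simp add: classes_of_def)

lemma class_items_subset:
  assumes "bpps_instance P" "c \<in> classes P"
  shows "class_items P c \<subseteq> items P"
  using assms unfolding bpps_instance_def by blast

text \<open>A class is nonempty, and any item of it has positive weight and fits into a bin together
  with the setup. This makes the denominator in \<open>gamma\<close> positive.\<close>

lemma setup_weight_less_capacity:
  assumes "bpps_instance P" "c \<in> classes P"
  shows "setup_weight P c < capacity P"
proof -
  obtain i where i: "i \<in> class_items P c"
    using assms unfolding bpps_instance_def by blast
  have "weight P i \<ge> 1" "weight P i + setup_weight P c \<le> capacity P"
    using assms i class_items_subset[OF assms] unfolding bpps_instance_def by blast+
  then show ?thesis by linarith
qed

text \<open>The ceiling is taken of a positive quotient. In the uniform solution this gives the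
  linking constraint: \<open>1 / k\<close> is at most \<open>gamma P c / k\<close>.\<close>

lemma gamma_ge_1:
  assumes "bpps_instance P" "c \<in> classes P"
  shows "gamma P c \<ge> 1"
proof -
  obtain i where i: "i \<in> class_items P c"
    using assms unfolding bpps_instance_def by blast
  have sub: "class_items P c \<subseteq> items P" by (rule class_items_subset[OF assms])
  then have fin: "finite (class_items P c)" by (rule finite_subset) simp
  have "weight P i \<ge> 1"
    using assms i sub unfolding bpps_instance_def by blast
  also have "weight P i \<le> (\<Sum>i\<in>class_items P c. weight P i)"
    using i fin by (intro member_le_sum) auto
  finally have "real (\<Sum>i\<in>class_items P c. weight P i) > 0"
    by (simp del: of_nat_sum)
  moreover have "real (capacity P) - real (setup_weight P c) > 0"
    using setup_weight_less_capacity[OF assms] by simp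
  ultimately show ?thesis unfolding gamma_def
    by (metis divide_pos_pos int_one_le_iff_zero_less zero_less_ceiling)
qed

section \<open>Feasible packings and existence of an optimal one\<close>

lemma finite_bpps_feasible:
  assumes "bpps_feasible P \<S>"
  shows "finite \<S>"
  using assms finite_elements[OF finite_items] unfolding bpps_feasible_def by blast

lemma finite_bin:
  assumes "bpps_feasible P \<S>" "S \<in> \<S>"
  shows "finite S"
  using assms finite_subset[OF _ finite_items]
  unfolding bpps_feasible_def packing_pattern_def by blast

lemma sum_items_bins:
  fixes g :: "nat \<Rightarrow> nat"
  assumes "bpps_feasible P \<S>"
  shows "(\<Sum>S\<in>\<S>. \<Sum>i\<in>S. g i) = (\<Sum>i\<in>items P. g i)"
proof -
  have part: "partition_on (items P) \<S>"
    using assms unfolding bpps_feasible_def by blast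
  have "(\<Sum>i\<in>\<Union>\<S>. g i) = (\<Sum>S\<in>\<S>. \<Sum>i\<in>S. g i)"
    using sum.Union_disjoint_sets[of \<S> g] finite_bin[OF assms] partition_onD2[OF part]
    by simp
  then show ?thesis using partition_onD1[OF part] by simp
qed

text \<open>\<open>bins_upper_bound\<close> constrains \<open>k\<close> only through optimal
  packings, so one is needed to extract information from it. Putting every item into a bin of its
  own is feasible because each item fits together with its setup.\<close>

lemma bpps_optimal_exists:
  assumes "bpps_instance P"
  obtains \<S> where "bpps_optimal P \<S>"
proof -
  let ?\<S> = "(\<lambda>i. {i}) ` items P"
  have "packing_pattern P {i}" if "i \<in> items P" for i
  proof -
    obtain c where c: "c \<in> classes P" "i \<in> class_items P c"
      using assms \<open>i \<in> items P\<close> unfolding bpps_instance_def by blast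
    have "classes_of P {i} = {c}"
      using assms c unfolding classes_of_def bpps_instance_def disjoint_family_on_def by blast
    then show ?thesis
      using assms c that unfolding packing_pattern_def bpps_instance_def by simp
  qed
  then have "bpps_feasible P ?\<S>"
    unfolding bpps_feasible_def partition_on_def disjoint_def by auto
  \<comment> \<open>Costs are natural numbers, so a nonempty set of packings contains a cheapest
    one.\<close>
  from ex_has_least_nat[of "bpps_feasible P", OF this, of "bpps_cost P"]
  show ?thesis using that unfolding bpps_optimal_def by blast
qed

section \<open>Number of bins per class and total load of a packing\<close>

definition class_bins :: "bpps \<Rightarrow> nat set set \<Rightarrow> nat \<Rightarrow> nat set set" where
  "class_bins P \<S> c = {S \<in> \<S>. c \<in> classes_of P S}"

text \<open>Each bin that contains items of class \<open>c\<close> also carries the setup of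
  \<open>c\<close>, which leaves at most \<open>capacity P - setup_weight P c\<close> for those
  items. Adding this up over all such bins bounds the weight of the class.\<close>

lemma gamma_le_card_class_bins:
  assumes inst: "bpps_instance P" and feas: "bpps_feasible P \<S>" and c: "c \<in> classes P"
  shows "gamma P c \<le> int (card (class_bins P \<S> c))"
proof -
  let ?I = "class_items P c" and ?B = "class_bins P \<S> c"
  have fin: "finite \<S>" by (rule finite_bpps_feasible[OF feas])
  have less: "setup_weight P c < capacity P" by (rule setup_weight_less_capacity[OF inst c])
  have bin: "(\<Sum>i\<in>S. if i \<in> ?I then weight P i else 0) \<le> capacity P - setup_weight P c"
    if "S \<in> ?B" for S
  proof -
    have S: "S \<in> \<S>" "c \<in> classes_of P S" using that unfolding class_bins_def by auto
    have "(\<Sum>i\<in>S. if i \<in> ?I then weight P i else 0) \<le> (\<Sum>i\<in>S. weight P i)"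
      by (intro sum_mono) auto
    moreover have "setup_weight P c \<le> (\<Sum>c\<in>classes_of P S. setup_weight P c)"
      using S by (intro member_le_sum) auto
    moreover have "(\<Sum>i\<in>S. weight P i) + (\<Sum>c\<in>classes_of P S. setup_weight P c) \<le> capacity P"
      using feas S unfolding bpps_feasible_def packing_pattern_def by blast
    ultimately show ?thesis by linarith
  qed
  have "(\<Sum>i\<in>?I. weight P i) = (\<Sum>i\<in>items P. if i \<in> ?I then weight P i else 0)"
    using class_items_subset[OF inst c] by (simp add: sum.If_cases inf.absorb2)
  also have "\<dots> = (\<Sum>S\<in>\<S>. \<Sum>i\<in>S. if i \<in> ?I then weight P i else 0)"
    by (rule sum_items_bins[OF feas, symmetric])
  \<comment> \<open>A bin outside \<open>?B\<close> holds no item of the class, so its inner sum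
    vanishes.\<close>
  also have "\<dots> = (\<Sum>S\<in>?B. \<Sum>i\<in>S. if i \<in> ?I then weight P i else 0)"
    using fin c
    by (intro sum.mono_neutral_right)
      (auto simp: class_bins_def classes_of_def disjoint_iff intro!: sum.neutral)
  also have "\<dots> \<le> (\<Sum>S\<in>?B. capacity P - setup_weight P c)"
    by (rule sum_mono) (rule bin)
  also have "\<dots> = card ?B * (capacity P - setup_weight P c)" by simp
  finally have "real (\<Sum>i\<in>?I. weight P i)
      \<le> real (card ?B * (capacity P - setup_weight P c))"
    by (simp only: of_nat_le_iff)
  \<comment> \<open>By \<open>less\<close>, the natural-number difference is not truncated and the
    divisor is positive. The bound is an integer, so it also bounds the ceiling.\<close>
  then have "real (\<Sum>i\<in>?I. weight P i) / (real (capacity P) - real (setup_weight P c))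
      \<le> real_of_int (int (card ?B))"
    using less by (simp add: divide_le_eq of_nat_diff del: of_nat_sum)
  then show ?thesis unfolding gamma_def by (rule ceiling_le)
qed

lemma card_class_bins_le:
  assumes "bpps_feasible P \<S>"
  shows "card (class_bins P \<S> c) \<le> card \<S>"
  using finite_bpps_feasible[OF assms] unfolding class_bins_def by (intro card_mono) auto

text \<open>Double counting: the setup of a class is charged once in each bin where the class
  occurs, so adding the capacity bounds of all bins gives the claim.\<close>

lemma total_load_le:
  assumes "bpps_feasible P \<S>"
  shows "(\<Sum>i\<in>items P. weight P i) + (\<Sum>c\<in>classes P. card (class_bins P \<S> c) * setup_weight P c)
         \<le> card \<S> * capacity P"
proof -
  have "(\<Sum>S\<in>\<S>. \<Sum>c\<in>classes_of P S. setup_weight P c)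
      = (\<Sum>S\<in>\<S>. \<Sum>c | c \<in> classes P \<and> c \<in> classes_of P S. setup_weight P c)"
    by (intro sum.cong refl) (auto simp: classes_of_def)
  also have "\<dots> = (\<Sum>c\<in>classes P. \<Sum>S\<in>class_bins P \<S> c. setup_weight P c)"
    unfolding class_bins_def
    by (rule sum.swap_restrict[OF finite_bpps_feasible[OF assms] finite_classes])
  finally have "(\<Sum>i\<in>items P. weight P i)
        + (\<Sum>c\<in>classes P. card (class_bins P \<S> c) * setup_weight P c)
      = (\<Sum>S\<in>\<S>. (\<Sum>i\<in>S. weight P i) + (\<Sum>c\<in>classes_of P S. setup_weight P c))"
    using sum_items_bins[OF assms, of "weight P"] by (simp add: sum.distrib)
  also have "\<dots> \<le> (\<Sum>S\<in>\<S>. capacity P)"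
    using assms unfolding bpps_feasible_def packing_pattern_def by (intro sum_mono) blast
  finally show ?thesis by simp
qed

lemma gamma_le_bound:
  assumes inst: "bpps_instance P" and ub: "bins_upper_bound P k" and c: "c \<in> classes P"
  shows "gamma P c \<le> int k"
proof -
  obtain \<S> where opt: "bpps_optimal P \<S>" using bpps_optimal_exists[OF inst] .
  then have feas: "bpps_feasible P \<S>" unfolding bpps_optimal_def by blast
  have "card \<S> \<le> k" using ub opt unfolding bins_upper_bound_def by blast
  then show ?thesis
    using gamma_le_card_class_bins[OF inst feas c] card_class_bins_le[OF feas, of c] by linarith
qed

text \<open>This is what keeps the uniform \<open>z\<close> at most \<open>1\<close>. In an optimal
  packing, replacing the number of bins of each class by the smaller \<open>gamma P c\<close> can
  only decrease the load.\<close>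

lemma gamma_load_le:
  assumes inst: "bpps_instance P" and ub: "bins_upper_bound P k"
  shows "(\<Sum>i\<in>items P. real (weight P i))
           + (\<Sum>c\<in>classes P. real_of_int (gamma P c) * real (setup_weight P c))
         \<le> real k * real (capacity P)"
proof -
  obtain \<S> where opt: "bpps_optimal P \<S>" using bpps_optimal_exists[OF inst] .
  then have feas: "bpps_feasible P \<S>" unfolding bpps_optimal_def by blast
  have "real_of_int (gamma P c) \<le> real (card (class_bins P \<S> c))" if "c \<in> classes P" for c
    using gamma_le_card_class_bins[OF inst feas that] by linarith
  then have "(\<Sum>c\<in>classes P. real_of_int (gamma P c) * real (setup_weight P c))
      \<le> (\<Sum>c\<in>classes P. real (card (class_bins P \<S> c)) * real (setup_weight P c))"
    by (intro sum_mono mult_right_mono) auto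
  moreover have "(\<Sum>i\<in>items P. real (weight P i))
        + (\<Sum>c\<in>classes P. real (card (class_bins P \<S> c)) * real (setup_weight P c))
      \<le> real (card \<S>) * real (capacity P)"
    using total_load_le[OF feas, folded of_nat_le_iff[where 'a = real]] by simp
  moreover have "card \<S> \<le> k" using ub opt unfolding bins_upper_bound_def by blast
  then have "real (card \<S>) * real (capacity P) \<le> real k * real (capacity P)"
    by (intro mult_right_mono) auto
  ultimately show ?thesis by linarith
qed

section \<open>Lower bound for the linear program\<close>

lemma lp_objective_lower_bound:
  assumes inst: "bpps_instance P" and feas: "lp_feasible P k x y z"
  shows "real (bin_cost P) / real (capacity P)
           * ((\<Sum>i\<in>items P. real (weight P i))
              + (\<Sum>c\<in>classes P. real_of_int (gamma P c) * real (setup_weight P c)))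
         + (\<Sum>c\<in>classes P. real_of_int (gamma P c) * real (setup_cost P c))
         \<le> lp_objective P k y z"
proof -
  let ?B = "{1..k}"
  let ?L = "(\<Sum>i\<in>items P. real (weight P i))
              + (\<Sum>c\<in>classes P. real_of_int (gamma P c) * real (setup_weight P c))"
  have cap: "real (capacity P) > 0" using inst unfolding bpps_instance_def by simp
  \<comment> \<open>The weights \<open>g\<close> are arbitrary because the minimum classes
    inequalities are needed twice: with setup weights for the load and with setup costs for the
    objective.\<close>
  have classes: "(\<Sum>c\<in>classes P. real_of_int (gamma P c) * real (g c))
      \<le> (\<Sum>b\<in>?B. \<Sum>c\<in>classes P. real (g c) * y c b)" for g :: "nat \<Rightarrow> nat"
  proof -
    have "(\<Sum>c\<in>classes P. real_of_int (gamma P c) * real (g c))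
        \<le> (\<Sum>c\<in>classes P. (\<Sum>b\<in>?B. y c b) * real (g c))"
      using feas unfolding lp_feasible_def by (intro sum_mono mult_right_mono) auto
    also have "\<dots> = (\<Sum>b\<in>?B. \<Sum>c\<in>classes P. real (g c) * y c b)"
      by (subst sum.swap) (simp add: sum_distrib_left mult.commute)
    finally show ?thesis .
  qed
  \<comment> \<open>After exchanging the sums, the assignment constraints turn the fractional item
    load into the exact total weight.\<close>
  have "(\<Sum>b\<in>?B. \<Sum>i\<in>items P. real (weight P i) * x i b)
      = (\<Sum>i\<in>items P. real (weight P i) * (\<Sum>b\<in>?B. x i b))"
    by (subst sum.swap) (simp add: sum_distrib_left)
  also have "\<dots> = (\<Sum>i\<in>items P. real (weight P i))"
    using feas unfolding lp_feasible_def by simp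
  finally have "?L \<le> (\<Sum>b\<in>?B. (\<Sum>i\<in>items P. real (weight P i) * x i b)
          + (\<Sum>c\<in>classes P. real (setup_weight P c) * y c b))"
    using classes[of "setup_weight P"] by (simp add: sum.distrib)
  also have "\<dots> \<le> (\<Sum>b\<in>?B. real (capacity P) * z b)"
    using feas unfolding lp_feasible_def by (intro sum_mono) auto
  also have "\<dots> = real (capacity P) * (\<Sum>b\<in>?B. z b)"
    by (simp add: sum_distrib_left)
  finally have "?L / real (capacity P) \<le> (\<Sum>b\<in>?B. z b)"
    using cap by (simp add: divide_le_eq mult.commute)
  then have "real (bin_cost P) * (?L / real (capacity P)) \<le> real (bin_cost P) * (\<Sum>b\<in>?B. z b)"
    by (rule mult_left_mono) simp
  then show ?thesis
    using classes[of "setup_cost P"]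
    unfolding lp_objective_def sum.distrib by (simp add: sum_distrib_left)
qed

section \<open>Feasibility and optimality of the uniform solution\<close>

theorem proposition4:
  fixes P :: bpps and k :: nat
  assumes "bpps_instance P"
    and "bins_upper_bound P k"
  shows "lp_optimal P k
           (\<lambda>i b. 1 / real k)
           (\<lambda>c b. real_of_int (gamma P c) / real k)
           (\<lambda>b. ((\<Sum>i\<in>items P. real (weight P i))
                  + (\<Sum>c\<in>classes P. real_of_int (gamma P c) * real (setup_weight P c)))
                / (real k * real (capacity P)))
       \<and> lp_value P k =
           real (bin_cost P) / real (capacity P)
             * ((\<Sum>i\<in>items P. real (weight P i))
                + (\<Sum>c\<in>classes P. real_of_int (gamma P c) * real (setup_weight P c)))
           + (\<Sum>c\<in>classes P. real_of_int (gamma P c) * real (setup_cost P c))"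
proof -
  let ?x = "\<lambda>(i::nat) (b::nat). 1 / real k"
  let ?y = "\<lambda>c (b::nat). real_of_int (gamma P c) / real k"
  let ?L = "(\<Sum>i\<in>items P. real (weight P i))
              + (\<Sum>c\<in>classes P. real_of_int (gamma P c) * real (setup_weight P c))"
  let ?z = "\<lambda>b::nat. ?L / (real k * real (capacity P))"
  let ?v = "real (bin_cost P) / real (capacity P) * ?L
              + (\<Sum>c\<in>classes P. real_of_int (gamma P c) * real (setup_cost P c))"
  have k: "real k \<ge> 1" using assms(2) unfolding bins_upper_bound_def by simp
  have cap: "real (capacity P) > 0" using assms(1) unfolding bpps_instance_def by simp
  have gamma: "1 \<le> real_of_int (gamma P c)" "real_of_int (gamma P c) \<le> real k"
    if "c \<in> classes P" for c
    using gamma_ge_1[OF assms(1) that] gamma_le_bound[OF assms that] by linarith+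
  have L_nonneg: "?L \<ge> 0"
  proof (intro add_nonneg_nonneg sum_nonneg mult_nonneg_nonneg)
    show "0 \<le> real_of_int (gamma P c)" if "c \<in> classes P" for c
      using gamma[OF that] by linarith
  qed auto
  \<comment> \<open>The choice of \<open>?z\<close> makes every capacity constraint tight.\<close>
  have "(\<Sum>i\<in>items P. real (weight P i) * ?x i b)
      + (\<Sum>c\<in>classes P. real (setup_weight P c) * ?y c b) = real (capacity P) * ?z b" for b :: nat
  proof -
    have "(\<Sum>i\<in>items P. real (weight P i) * ?x i b)
        + (\<Sum>c\<in>classes P. real (setup_weight P c) * ?y c b) = ?L / real k"
      by (simp add: sum_divide_distrib add_divide_distrib mult.commute)
    also have "\<dots> = real (capacity P) * ?z b" using cap by simp
    finally show ?thesis .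
  qed
  moreover have "0 \<le> ?z b" "?z b \<le> 1" for b :: nat
    using L_nonneg gamma_load_le[OF assms] k cap by (auto simp: divide_le_eq_1)
  \<comment> \<open>The first two bounds use \<open>gamma P c\<close> \<ge> \<open>1\<close>, the
    last one uses \<open>gamma P c\<close> \<le> \<open>k\<close>.\<close>
  moreover have "?x i b \<le> ?y c b" "0 \<le> ?y c b" "?y c b \<le> 1" if "c \<in> classes P" for i c b :: nat
    using gamma[OF that] k by (auto simp: divide_right_mono)
  ultimately have feas: "lp_feasible P k ?x ?y ?z"
    using k unfolding lp_feasible_def by auto
  have bins: "real k * (real (bin_cost P) * (L / (real k * real (capacity P))))
      = real (bin_cost P) / real (capacity P) * L" for L
    using k by simp
  have setups: "real k * (\<Sum>c\<in>classes P. real (setup_cost P c) * ?y c b)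
      = (\<Sum>c\<in>classes P. real_of_int (gamma P c) * real (setup_cost P c))" for b :: nat
    unfolding sum_distrib_left using k by (intro sum.cong) auto
  \<comment> \<open>All \<open>k\<close> bins contribute equally. The index \<open>0\<close> is not
    a bin, only an arbitrary argument of functions that are constant in it.\<close>
  have "lp_objective P k ?y ?z = real k * (real (bin_cost P) * ?z 0)
      + real k * (\<Sum>c\<in>classes P. real (setup_cost P c) * ?y c 0)"
    unfolding lp_objective_def sum.distrib sum_constant card_atLeastAtMost by simp
  then have obj: "lp_objective P k ?y ?z = ?v"
    unfolding bins setups .
  have lower: "?v \<le> lp_objective P k y z" if "lp_feasible P k x y z" for x y z
    by (rule lp_objective_lower_bound[OF assms(1) that])
  have "lp_optimal P k ?x ?y ?z"
    unfolding lp_optimal_def obj using feas lower by blast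
  moreover have "lp_value P k = ?v"
    unfolding lp_value_def
    \<comment> \<open>The lower bound is attained by the uniform solution, so the infimum is a
      minimum.\<close>
    by (rule cInf_eq_minimum) (use feas obj lower in \<open>force+\<close>)
  ultimately show ?thesis by blast
qed

end
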